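(* Let $(X,[\cdot,\cdot]_X)$ and $(Y,[\cdot,\cdot]_Y)$ be Krein spaces, let $H:X\to Y$ be a linear relation, and let $H^*:Y\to X$ be the adjoint linear relation of $H$. Then: (i) $H^*$ is a closed linear relation; (ii) $(\overline{H})^*=H^*$; (iii) $\overline{H}=H^{**}$; (iv) $(\operatorname{dom}H)^{[\perp]_X}=\operatorname{mul}H^*$; (v) $\ker H^*=(\operatorname{ran}H)^{[\perp]_Y}$; (vi) $\overline{\operatorname{dom}\overline{H}}=\overline{\operatorname{dom}H}$ and $\overline{\operatorname{ran}\overline{H}}=\overline{\operatorname{ran}H}$.
   Context: Krein spaces carry the topology of an associated Hilbert space, and $X\times Y$ the product topology. A linear relation $H:X\to Y$ is a linear subspace $H\subseteq X\times Y$; it is closed if it is closed in $X\times Y$, and $\overline{H}$ is its closure. $\operatorname{dom}H=\{x:(x,y)\in H\text{ for some }y\}$, $\operatorname{ran}H=\{y:(x,y)\in H\text{ for some }x\}$, $\ker H=\{x:(x,0)\in H\}$, $\operatorname{mul}H=\{y:(0,y)\in H\}$. The adjoint is $$H^*=\{(k,h)\in Y\times X:[f,h]_X=[g,k]_Y\ \text{for all }(f,g)\in H\}.$$ $A^{[\perp]_X}=\{y\in X:[x,y]_X=0\ \forall x\in A\}$, and similarly for $Y$. *)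

theory Defs
  imports "HOL-Analysis.Analysis"
begin

class scaleC =
  fixes scaleC :: "complex \<Rightarrow> 'a \<Rightarrow> 'a" (infixr \<open>*\<^sub>C\<close> 75)

class complex_vector = scaleC + ab_group_add +
  assumes scaleC_add_right: "a *\<^sub>C (x + y) = a *\<^sub>C x + a *\<^sub>C y"
    and scaleC_add_left: "(a + b) *\<^sub>C x = a *\<^sub>C x + b *\<^sub>C x"
    and scaleC_scaleC: "a *\<^sub>C b *\<^sub>C x = (a * b) *\<^sub>C x"
    and scaleC_one: "1 *\<^sub>C x = x"

interpretation complex_vector: vector_space "scaleC :: complex \<Rightarrow> 'a \<Rightarrow> 'a::complex_vector"
  by unfold_locales (fact scaleC_add_right scaleC_add_left scaleC_scaleC scaleC_one)+

definition (in complex_vector) csubspace :: "'a set \<Rightarrow> bool" where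
  "csubspace V \<longleftrightarrow>
     0 \<in> V \<and> (\<forall>x\<in>V. \<forall>y\<in>V. x + y \<in> V) \<and> (\<forall>c. \<forall>x\<in>V. c *\<^sub>C x \<in> V)"

lemma csubspace_eq_subspace:
  "csubspace = module.subspace (scaleC :: complex \<Rightarrow> 'a \<Rightarrow> 'a::complex_vector)"
  by (rule ext) (simp add: csubspace_def complex_vector.subspace_def)

instantiation prod :: (complex_vector, complex_vector) complex_vector
begin

definition scaleC_prod_def: "c *\<^sub>C z = (c *\<^sub>C fst z, c *\<^sub>C snd z)"

instance
  by standard (auto simp: scaleC_prod_def scaleC_add_right scaleC_add_left scaleC_scaleC scaleC_one)

end

definition (in complex_vector) hermitian_form :: "('a \<Rightarrow> 'a \<Rightarrow> complex) \<Rightarrow> bool" where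
  "hermitian_form b \<longleftrightarrow>
     (\<forall>x y z. b (x + y) z = b x z + b y z) \<and>
     (\<forall>c x y. b (c *\<^sub>C x) y = c * b x y) \<and>
     (\<forall>x y. b x y = cnj (b y x))"

text \<open>The absolute value is the identity wherever \<open>b\<close> is positive, which is the only
  place where this distance is used.  It is there because \<^locale>\<open>Metric_space\<close> demands
  nonnegativity on the whole type, not just on the carrier.\<close>

definition (in complex_vector) form_dist :: "('a \<Rightarrow> 'a \<Rightarrow> complex) \<Rightarrow> 'a \<Rightarrow> 'a \<Rightarrow> real" where
  "form_dist b x y = sqrt \<bar>Re (b (x - y) (x - y))\<bar>"

definition (in complex_vector) hilbert_subspace :: "('a \<Rightarrow> 'a \<Rightarrow> complex) \<Rightarrow> 'a set \<Rightarrow> bool" where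
  "hilbert_subspace b V \<longleftrightarrow>
     hermitian_form b \<and> csubspace V \<and>
     (\<forall>x\<in>V. x \<noteq> 0 \<longrightarrow> 0 < Re (b x x)) \<and>
     Metric_space.mcomplete V (form_dist b)"

definition (in complex_vector) fundamental_decomposition ::
    "('a \<Rightarrow> 'a \<Rightarrow> complex) \<Rightarrow> 'a set \<Rightarrow> 'a set \<Rightarrow> bool" where
  "fundamental_decomposition b P N \<longleftrightarrow>
     hilbert_subspace b P \<and> hilbert_subspace (\<lambda>x y. - b x y) N \<and>
     (\<forall>p\<in>P. \<forall>n\<in>N. b p n = 0) \<and>
     P \<inter> N = {0} \<and> (\<forall>x. \<exists>p\<in>P. \<exists>n\<in>N. x = p + n)"

definition (in complex_vector) fundamental_symmetry :: "'a set \<Rightarrow> 'a set \<Rightarrow> 'a \<Rightarrow> 'a" where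
  "fundamental_symmetry P N x = (THE z. \<exists>p\<in>P. \<exists>n\<in>N. x = p + n \<and> z = p - n)"

definition (in complex_vector) associated_inner ::
    "('a \<Rightarrow> 'a \<Rightarrow> complex) \<Rightarrow> 'a set \<Rightarrow> 'a set \<Rightarrow> 'a \<Rightarrow> 'a \<Rightarrow> complex" where
  "associated_inner b P N x y = b (fundamental_symmetry P N x) y"

text \<open>The fundamental decomposition is not part of the structure.  Only its Hilbert space
  topology is, and this does not depend on the choice of the decomposition.\<close>

class krein_space = complex_vector + topological_space +
  fixes krein_form :: "'a \<Rightarrow> 'a \<Rightarrow> complex"
  assumes hermitian_krein_form: "hermitian_form krein_form"
    and ex_fundamental_decomposition:
      "\<exists>P N. fundamental_decomposition krein_form P N \<and>
         (\<forall>U. open U \<longleftrightarrow>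
            openin (Metric_space.mtopology UNIV (form_dist (associated_inner krein_form P N))) U)"

definition linear_relation :: "('a::complex_vector \<times> 'b::complex_vector) set \<Rightarrow> bool" where
  "linear_relation H \<longleftrightarrow> csubspace H"

text \<open>The domain and range of a relation are \<^const>\<open>Domain\<close> and \<^const>\<open>Range\<close>.\<close>

definition rel_ker :: "('a::complex_vector \<times> 'b::complex_vector) set \<Rightarrow> 'a set" where
  "rel_ker H = {x. (x, 0) \<in> H}"

definition rel_mul :: "('a::complex_vector \<times> 'b::complex_vector) set \<Rightarrow> 'b set" where
  "rel_mul H = {y. (0, y) \<in> H}"

definition rel_adjoint :: "('a::krein_space \<times> 'b::krein_space) set \<Rightarrow> ('b \<times> 'a) set" where
  "rel_adjoint H = {(k, h). \<forall>(f, g)\<in>H. krein_form f h = krein_form g k}"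

definition krein_orth :: "'a::krein_space set \<Rightarrow> 'a set" where
  "krein_orth A = {y. \<forall>x\<in>A. krein_form x y = 0}"

end

theory Submission
  imports Defs
begin

text \<open>
  Everything but \<open>H\<^sup>*\<^sup>* \<subseteq> closure H\<close> is formal once the Krein form is known to be
  continuous in each argument: the adjoint of any relation is then an intersection of closed
  sets, and so is the set of pairs that a given pair of \<open>H\<^sup>*\<close> annihilates.  The equalities of
  domains and ranges only use that the coordinate projections are continuous.

  A fundamental symmetry \<open>J\<close> turns the Krein form into a Hilbert inner product
  \<open>q x y = [x, J y]\<close> that induces the topology, and since \<open>J\<close> is an involution also
  \<open>[x, y] = q x (J y)\<close>; continuity is then the Cauchy-Schwarz inequality
  (\<open>krein_hilbert_form\<close>, \<open>continuous_krein_form\<close>).  The inner products of \<open>X\<close> and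
  \<open>Y\<close> add up to one on \<open>X \<times> Y\<close> (\<open>hilbert_form_prod\<close>), where every point \<open>z\<close> has a
  best approximation \<open>l\<close> in the closure of \<open>H\<close>, and \<open>w = z - l\<close> is orthogonal to \<open>H\<close>
  (\<open>orthogonal_decomposition\<close>).  In terms of the Krein forms, this orthogonality says that
  \<open>(- J w\<^sub>2, J w\<^sub>1)\<close> lies in \<open>H\<^sup>*\<close>.  If \<open>z\<close> is in \<open>H\<^sup>*\<^sup>*\<close>, then both \<open>z\<close> and \<open>l\<close>
  are annihilated by this pair, which means that both are orthogonal to \<open>w\<close>.  Hence \<open>w\<close> is
  orthogonal to itself, and \<open>z = l\<close> lies in the closure of \<open>H\<close>.
\<close>

section \<open>Hermitian forms\<close>

lemma scaleC_minus_one: "(- 1) *\<^sub>C x = - (x :: 'a::complex_vector)"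
  using complex_vector.scale_minus_left[of 1 x] by (simp add: scaleC_one)

lemma csubspace_diff:
  fixes V :: "'a::complex_vector set"
  assumes "csubspace V" "x \<in> V" "y \<in> V"
  shows "x - y \<in> V"
  using assms complex_vector.subspace_diff by (auto simp: csubspace_eq_subspace)

locale hermitian_space =
  fixes q :: "'a::complex_vector \<Rightarrow> 'a \<Rightarrow> complex"
  assumes hermitian: "hermitian_form q"
begin

lemma form_add_left: "q (x + y) z = q x z + q y z"
  and form_scaleC_left: "q (c *\<^sub>C x) z = c * q x z"
  and form_cnj: "cnj (q x y) = q y x"
  using hermitian unfolding hermitian_form_def by (blast, blast, metis)

lemma form_add_right: "q z (x + y) = q z x + q z y"
  by (metis form_cnj form_add_left complex_cnj_add)

lemma form_scaleC_right: "q z (c *\<^sub>C x) = cnj c * q z x"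
  by (metis form_cnj form_scaleC_left complex_cnj_mult)

lemma form_minus_left: "q (- x) z = - q x z"
  using form_scaleC_left[of "- 1" x z] by (simp add: scaleC_minus_one)

lemma form_minus_right: "q z (- x) = - q z x"
  using form_scaleC_right[of z "- 1" x] by (simp add: scaleC_minus_one)

lemma form_diff_left: "q (x - y) z = q x z - q y z"
  using form_add_left[of x "- y" z] by (simp add: form_minus_left)

lemma form_diff_right: "q z (x - y) = q z x - q z y"
  using form_add_right[of z x "- y"] by (simp add: form_minus_right)

lemma form_zero_left: "q 0 z = 0"
  using form_diff_left[of 0 0 z] by simp

lemma form_zero_right: "q z 0 = 0"
  using form_diff_right[of z 0 0] by simp

lemmas form_simps = form_add_left form_add_right form_scaleC_left form_scaleC_right
  form_minus_left form_minus_right form_diff_left form_diff_right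
  form_zero_left form_zero_right

lemma form_self_real: "q x x = complex_of_real (Re (q x x))"
  using form_cnj[of x x] by (metis Reals_cnj_iff of_real_Re)

lemma form_dist_commute: "form_dist q x y = form_dist q y x"
  using form_minus_left[of "x - y" "x - y"] form_minus_right[of "- (x - y)" "x - y"]
  by (simp add: form_dist_def form_minus_left form_minus_right)

end

section \<open>Positive definite forms and their distance\<close>

locale positive_form = hermitian_space q for q :: "'a::complex_vector \<Rightarrow> 'a \<Rightarrow> complex" +
  assumes form_pos: "x \<noteq> 0 \<Longrightarrow> 0 < Re (q x x)"
begin

definition form_norm :: "'a \<Rightarrow> real" where
  "form_norm x = sqrt (Re (q x x))"

lemma form_self_nonneg: "0 \<le> Re (q x x)"
  using form_pos[of x] by (cases "x = 0") (auto simp: form_zero_left)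

lemma form_norm_nonneg: "0 \<le> form_norm x"
  by (simp add: form_norm_def form_self_nonneg)

lemma form_norm_square: "(form_norm x)\<^sup>2 = Re (q x x)"
  by (simp add: form_norm_def form_self_nonneg)

lemma form_norm_eq_0: "form_norm x = 0 \<longleftrightarrow> x = 0"
  using form_pos[of x] by (cases "x = 0") (auto simp: form_norm_def form_zero_left)

lemma form_dist_norm: "form_dist q x y = form_norm (x - y)"
  by (simp add: form_dist_def form_norm_def form_self_nonneg)

text \<open>The square of the norm of the component of \<open>x\<close> orthogonal to \<open>y\<close>.  That it is
  nonnegative is the Cauchy-Schwarz inequality; that it is smaller than the square of the norm
  of \<open>x\<close> unless \<open>x\<close> is orthogonal to \<open>y\<close> makes best approximations orthogonal.\<close>

lemma form_norm_component:
  assumes "y \<noteq> 0"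
  shows "(form_norm (x - (q x y / q y y) *\<^sub>C y))\<^sup>2
    = (form_norm x)\<^sup>2 - (cmod (q x y))\<^sup>2 / (form_norm y)\<^sup>2"
proof -
  define r where "r = Re (q y y)"
  have r: "r > 0" "q y y = complex_of_real r"
    using form_pos[OF assms] form_self_real[of y] by (auto simp: r_def)
  define s where "s = q x y"
  have yx: "q y x = cnj s"
    by (simp add: s_def form_cnj)
  have "q (x - (s / r) *\<^sub>C y) (x - (s / r) *\<^sub>C y) = q x x - s * cnj s / r"
    using r(1) by (simp add: form_simps yx r(2) s_def[symmetric])
  also have "s * cnj s / r = complex_of_real ((cmod s)\<^sup>2 / r)"
    by (simp add: complex_norm_square[symmetric])
  finally show ?thesis
    by (simp add: form_norm_square r(2) s_def)
qed

lemma Cauchy_Schwarz: "cmod (q x y) \<le> form_norm x * form_norm y"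
proof (cases "y = 0")
  case False
  have "0 \<le> (form_norm x)\<^sup>2 - (cmod (q x y))\<^sup>2 / (form_norm y)\<^sup>2"
    using form_norm_component[OF False, of x] by (metis zero_le_power2)
  moreover have "0 < (form_norm y)\<^sup>2"
    using False by (simp add: form_norm_eq_0)
  ultimately have "(cmod (q x y))\<^sup>2 \<le> (form_norm x * form_norm y)\<^sup>2"
    by (simp add: field_simps power_mult_distrib)
  then show ?thesis
    by (rule power2_le_imp_le) (simp add: form_norm_nonneg)
qed (simp add: form_zero_right form_norm_nonneg)

lemma form_norm_add_square:
  "(form_norm (x + y))\<^sup>2 = (form_norm x)\<^sup>2 + 2 * Re (q x y) + (form_norm y)\<^sup>2"
proof -
  have "Re (q y x) = Re (q x y)"
    by (metis form_cnj complex_cnj(1) complex.sel(1) complex_surj)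
  then show ?thesis
    by (simp add: form_norm_square form_simps)
qed

lemma form_norm_triangle: "form_norm (x + y) \<le> form_norm x + form_norm y"
proof (rule power2_le_imp_le)
  have "Re (q x y) \<le> form_norm x * form_norm y"
    using Cauchy_Schwarz[of x y] complex_Re_le_cmod order_trans by blast
  then show "(form_norm (x + y))\<^sup>2 \<le> (form_norm x + form_norm y)\<^sup>2"
    by (simp add: form_norm_add_square power2_sum)
qed (simp add: form_norm_nonneg)

lemma form_norm_minus: "form_norm (- x) = form_norm x"
  by (simp add: form_norm_def form_simps)

lemma parallelogram:
  "(form_norm (x - y))\<^sup>2 = 2 * (form_norm x)\<^sup>2 + 2 * (form_norm y)\<^sup>2 - (form_norm (x + y))\<^sup>2"
  using form_norm_add_square[of x "- y"] form_norm_add_square[of x y]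
  by (simp add: form_simps form_norm_minus)

lemma form_dist_triangle: "form_dist q x z \<le> form_dist q x y + form_dist q y z"
  using form_norm_triangle[of "x - y" "y - z"] by (simp add: form_dist_norm)

lemma form_dist_nonneg: "0 \<le> form_dist q x y"
  by (simp add: form_dist_norm form_norm_nonneg)

lemma form_dist_eq_0: "form_dist q x y = 0 \<longleftrightarrow> x = y"
  by (simp add: form_dist_norm form_norm_eq_0)

lemma form_dist_add: "form_dist q (x + y) (x' + y') \<le> form_dist q x x' + form_dist q y y'"
  using form_norm_triangle[of "x - x'" "y - y'"] by (simp add: form_dist_norm add_diff_add)

lemma Metric_space_form_dist: "Metric_space UNIV (form_dist q)"
  by unfold_locales
    (rule form_dist_nonneg form_dist_commute form_dist_eq_0 form_dist_triangle)+

end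

section \<open>Inner products of Hilbert space topologies\<close>

text \<open>The topology is fixed by its neighbourhood filters, so that convergence along any
  filter is convergence of distances to zero; this form passes to products without choosing a
  metric for the product topology.  Sequences suffice for completeness.\<close>

locale hilbert_form = positive_form q
  for q :: "'a::{complex_vector,topological_space} \<Rightarrow> 'a \<Rightarrow> complex" +
  assumes nhds_eq: "nhds l = filtercomap (\<lambda>x. form_dist q x l) (nhds 0)"
    and form_complete: "(\<And>e. 0 < e \<Longrightarrow> \<exists>k. \<forall>m\<ge>k. \<forall>n\<ge>k. form_dist q (\<sigma> m) (\<sigma> n) < e)
      \<Longrightarrow> \<exists>l. \<sigma> \<longlonglongrightarrow> l"
begin

lemma tendsto_iff_form_dist: "(f \<longlongrightarrow> l) F \<longleftrightarrow> ((\<lambda>n. form_dist q (f n) l) \<longlongrightarrow> 0) F"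
  by (simp add: nhds_eq filterlim_filtercomap_iff o_def)

lemma continuous_form_left: "continuous_on UNIV (\<lambda>x. q x y)"
proof -
  have "((\<lambda>x. q x y) \<longlongrightarrow> q l y) (at l)" for l
  proof (rule Lim_null[THEN iffD2], rule Lim_null_comparison)
    have "((\<lambda>x. form_dist q x l) \<longlongrightarrow> 0) (at l)"
      using tendsto_iff_form_dist[of "\<lambda>x. x" l "at l"] by (simp add: tendsto_ident_at)
    then show "((\<lambda>x. form_dist q x l * form_norm y) \<longlongrightarrow> 0) (at l)"
      by (rule tendsto_mult_left_zero)
    show "\<forall>\<^sub>F x in at l. norm (q x y - q l y) \<le> form_dist q x l * form_norm y"
      using Cauchy_Schwarz[of "_ - l" y] by (simp add: form_dist_norm form_diff_left)
  qed
  then show ?thesis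
    by (simp add: continuous_on_def)
qed

text \<open>A minimizing sequence for the distance of \<open>z\<close> from \<open>V\<close> is a Cauchy sequence by the
  parallelogram law, because the midpoint of two of its members is no closer to \<open>z\<close> than the
  infimum.\<close>

lemma best_approximation:
  assumes V: "csubspace V"
  obtains l where "l \<in> closure V" "\<And>v. v \<in> V \<Longrightarrow> form_norm (z - l) \<le> form_norm (z - l - v)"
proof -
  define d where "d = (INF v\<in>V. (form_norm (z - v))\<^sup>2)"
  have ne: "V \<noteq> {}"
    using V by (auto simp: csubspace_def)
  have bdd: "bdd_below ((\<lambda>v. (form_norm (z - v))\<^sup>2) ` V)"
    by (rule bdd_belowI[of _ 0]) auto
  have d_le: "d \<le> (form_norm (z - v))\<^sup>2" if "v \<in> V" for v
    unfolding d_def using that bdd by (rule cINF_lower[rotated])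
  have "\<exists>v\<in>V. (form_norm (z - v))\<^sup>2 < d + inverse (real (Suc n))" for n
    using cINF_less_iff[OF ne bdd, of "d + inverse (real (Suc n))"] by (simp add: d_def)
  then obtain \<sigma> where \<sigma>: "\<And>n. \<sigma> n \<in> V"
    "\<And>n. (form_norm (z - \<sigma> n))\<^sup>2 < d + inverse (real (Suc n))"
    by metis
  have close: "(form_dist q (\<sigma> m) (\<sigma> n))\<^sup>2 < 4 * inverse (real (Suc k))"
    if "k \<le> m" "k \<le> n" for m n k
  proof -
    \<comment> \<open>The midpoint belongs to \<open>V\<close>, which bounds the subtracted term of the parallelogram law
      below by \<open>4 * d\<close>.\<close>
    have mid: "(1/2) *\<^sub>C (\<sigma> m + \<sigma> n) \<in> V"
      using \<sigma>(1) V by (auto simp: csubspace_def)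
    have "2 *\<^sub>C (z - (1/2) *\<^sub>C (\<sigma> m + \<sigma> n)) = 2 *\<^sub>C z - (\<sigma> m + \<sigma> n)"
      by (simp add: complex_vector.scale_right_diff_distrib scaleC_scaleC scaleC_one)
    also have "2 *\<^sub>C z = z + z"
      using scaleC_add_left[of 1 1 z] by (simp add: scaleC_one)
    finally have "(z - \<sigma> m) + (z - \<sigma> n) = 2 *\<^sub>C (z - (1/2) *\<^sub>C (\<sigma> m + \<sigma> n))"
      by simp
    then have "(form_norm ((z - \<sigma> m) + (z - \<sigma> n)))\<^sup>2
        = 4 * (form_norm (z - (1/2) *\<^sub>C (\<sigma> m + \<sigma> n)))\<^sup>2"
      by (simp only: form_norm_square form_scaleC_left form_scaleC_right) simp
    then have "4 * d \<le> (form_norm ((z - \<sigma> m) + (z - \<sigma> n)))\<^sup>2"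
      using d_le[OF mid] by simp
    moreover have "form_dist q (\<sigma> m) (\<sigma> n) = form_norm ((z - \<sigma> n) - (z - \<sigma> m))"
      by (simp add: form_dist_norm)
    moreover have "inverse (real (Suc m)) \<le> inverse (real (Suc k))"
      "inverse (real (Suc n)) \<le> inverse (real (Suc k))"
      using that by auto
    ultimately show ?thesis
      using parallelogram[of "z - \<sigma> n" "z - \<sigma> m"] \<sigma>(2)[of m] \<sigma>(2)[of n]
      by (simp only: add.commute)
  qed
  have "\<exists>l. \<sigma> \<longlonglongrightarrow> l"
  proof (rule form_complete)
    fix e :: real assume "0 < e"
    then have "0 < e\<^sup>2 / 4"
      by simp
    then obtain k where k: "inverse (real (Suc k)) < e\<^sup>2 / 4"
      using reals_Archimedean by blast
    have "form_dist q (\<sigma> m) (\<sigma> n) < e" if "k \<le> m" "k \<le> n" for m n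
      using close[OF that] k \<open>0 < e\<close> by (intro power2_less_imp_less[of _ e]) auto
    then show "\<exists>k. \<forall>m\<ge>k. \<forall>n\<ge>k. form_dist q (\<sigma> m) (\<sigma> n) < e"
      by blast
  qed
  then obtain l where l: "\<sigma> \<longlonglongrightarrow> l"
    by blast
  have lim: "(\<lambda>n. form_norm (u - \<sigma> n)) \<longlonglongrightarrow> form_norm (u - l)" for u
  proof (rule Lim_null[THEN iffD2], rule Lim_null_comparison)
    show "(\<lambda>n. form_dist q (\<sigma> n) l) \<longlonglongrightarrow> 0"
      using l by (simp add: tendsto_iff_form_dist)
    have "\<bar>form_norm (u - \<sigma> n) - form_norm (u - l)\<bar> \<le> form_dist q (\<sigma> n) l" for n
      using form_dist_triangle[of u l "\<sigma> n"] form_dist_triangle[of u "\<sigma> n" l]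
      by (simp add: form_dist_norm[symmetric] form_dist_commute[of l])
    then show "\<forall>\<^sub>F n in sequentially. norm (form_norm (u - \<sigma> n) - form_norm (u - l))
        \<le> form_dist q (\<sigma> n) l"
      by simp
  qed
  show thesis
  proof
    show "l \<in> closure V"
      using \<sigma>(1) closure_subset by (intro Lim_in_closed_set[OF _ _ _ l]) (auto intro: always_eventually)
    fix v assume v: "v \<in> V"
    have "d \<le> (form_norm (z - v - \<sigma> n))\<^sup>2" for n
      using d_le[of "v + \<sigma> n"] v \<sigma>(1)[of n] V by (simp add: csubspace_def diff_diff_eq)
    then have "d \<le> (form_norm (z - v - l))\<^sup>2"
      by (intro tendsto_lowerbound[OF tendsto_power[OF lim]]) auto
    moreover have "(form_norm (z - l))\<^sup>2 \<le> d"
    proof (rule tendsto_le[OF _ _ tendsto_power[OF lim[of z]]])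
      show "(\<lambda>n. d + inverse (real (Suc n))) \<longlonglongrightarrow> d"
        using tendsto_add[OF tendsto_const LIMSEQ_inverse_real_of_nat, of d] by simp
      show "\<forall>\<^sub>F n in sequentially. (form_norm (z - \<sigma> n))\<^sup>2 \<le> d + inverse (real (Suc n))"
        using \<sigma>(2) by (simp add: less_imp_le)
    qed simp
    ultimately have "(form_norm (z - l))\<^sup>2 \<le> (form_norm (z - l - v))\<^sup>2"
      by (simp add: algebra_simps)
    then show "form_norm (z - l) \<le> form_norm (z - l - v)"
      by (rule power2_le_imp_le) (rule form_norm_nonneg)
  qed
qed

text \<open>Subtracting from \<open>z - l\<close> its component along \<open>v \<in> V\<close> cannot shorten it, so this
  component vanishes.\<close>

lemma orthogonal_decomposition:
  assumes V: "csubspace V"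
  obtains l where "l \<in> closure V" "\<And>v. v \<in> V \<Longrightarrow> q v (z - l) = 0"
proof -
  obtain l where l: "l \<in> closure V"
    and best: "\<And>v. v \<in> V \<Longrightarrow> form_norm (z - l) \<le> form_norm (z - l - v)"
    using best_approximation[OF V, of z] by blast
  have "q v (z - l) = 0" if "v \<in> V" for v
  proof (cases "v = 0")
    case False
    define w where "w = z - l"
    have "(q w v / q v v) *\<^sub>C v \<in> V"
      using V that by (simp add: csubspace_def)
    then have "(form_norm w)\<^sup>2 \<le> (form_norm (w - (q w v / q v v) *\<^sub>C v))\<^sup>2"
      using best by (simp add: w_def power_mono form_norm_nonneg)
    then have "(cmod (q w v))\<^sup>2 / (form_norm v)\<^sup>2 \<le> 0"
      using form_norm_component[OF False, of w] by simp
    then have "q w v = 0"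
      using False by (simp add: divide_le_0_iff form_norm_eq_0)
    then show ?thesis
      using form_cnj[of w v] by (simp add: w_def)
  qed (simp add: form_zero_left)
  then show thesis
    using l that by blast
qed

end

text \<open>The distance of the sum is the Euclidean combination of the distances of the
  components.  It dominates both of them and tends to zero when both of them do, hence it
  induces the product topology and is complete.\<close>

lemma hilbert_form_prod:
  fixes q :: "'a::{complex_vector,topological_space} \<Rightarrow> 'a \<Rightarrow> complex"
    and r :: "'b::{complex_vector,topological_space} \<Rightarrow> 'b \<Rightarrow> complex"
  assumes "hilbert_form q" "hilbert_form r"
  shows "hilbert_form (\<lambda>z w. q (fst z) (fst w) + r (snd z) (snd w))" (is "hilbert_form ?s")
proof -
  interpret q: hilbert_form q by fact
  interpret r: hilbert_form r by fact
  interpret s: positive_form ?s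
  proof
    show "hermitian_form ?s"
      unfolding hermitian_form_def
      by (intro conjI allI)
        (simp_all add: q.form_simps r.form_simps scaleC_prod_def algebra_simps
          q.form_cnj r.form_cnj)
    fix z :: "'a \<times> 'b" assume "z \<noteq> 0"
    then have "fst z \<noteq> 0 \<or> snd z \<noteq> 0"
      by (simp add: prod_eq_iff)
    then show "0 < Re (?s z z)"
      using q.form_pos[of "fst z"] r.form_pos[of "snd z"] q.form_self_nonneg[of "fst z"]
        r.form_self_nonneg[of "snd z"] by auto
  qed
  have dist: "form_dist ?s z w
      = sqrt ((form_dist q (fst z) (fst w))\<^sup>2 + (form_dist r (snd z) (snd w))\<^sup>2)" for z w
    unfolding s.form_dist_norm s.form_norm_def
    by (simp add: q.form_dist_norm r.form_dist_norm q.form_norm_square r.form_norm_square)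
  have fst_le: "form_dist q (fst z) (fst w) \<le> form_dist ?s z w" for z w
    unfolding dist by (rule real_le_rsqrt) simp
  have snd_le: "form_dist r (snd z) (snd w) \<le> form_dist ?s z w" for z w
    unfolding dist by (rule real_le_rsqrt) simp
  show ?thesis
  proof
    fix l :: "'a \<times> 'b"
    let ?F = "filtercomap (\<lambda>z. form_dist ?s z l) (nhds 0)"
    have lim0: "((\<lambda>z. form_dist ?s z l) \<longlongrightarrow> 0) ?F"
      by (rule filterlim_filtercomap)
    show "nhds l = ?F"
    proof (rule antisym)
      have "((\<lambda>z. z) \<longlongrightarrow> l) (nhds l)"
        by (rule filterlim_ident)
      then have "((\<lambda>z. form_dist q (fst z) (fst l)) \<longlongrightarrow> 0) (nhds l)"
        "((\<lambda>z. form_dist r (snd z) (snd l)) \<longlongrightarrow> 0) (nhds l)"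
        unfolding q.tendsto_iff_form_dist[symmetric] r.tendsto_iff_form_dist[symmetric]
        by (auto intro: tendsto_fst tendsto_snd)
      then have "((\<lambda>z. form_dist ?s z l) \<longlongrightarrow> 0) (nhds l)"
        unfolding dist by (auto intro!: tendsto_eq_intros)
      then show "nhds l \<le> ?F"
        by (simp add: filterlim_iff_le_filtercomap)
    next
      have "(fst \<longlongrightarrow> fst l) ?F"
        unfolding q.tendsto_iff_form_dist
        by (rule tendsto_sandwich[OF _ _ tendsto_const lim0])
          (auto simp: fst_le q.form_dist_nonneg)
      moreover have "(snd \<longlongrightarrow> snd l) ?F"
        unfolding r.tendsto_iff_form_dist
        by (rule tendsto_sandwich[OF _ _ tendsto_const lim0])
          (auto simp: snd_le r.form_dist_nonneg)
      ultimately have "((\<lambda>z. (fst z, snd z)) \<longlongrightarrow> (fst l, snd l)) ?F"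
        by (rule tendsto_Pair)
      then show "?F \<le> nhds l"
        by (simp add: filterlim_def filtermap_ident)
    qed
  next
    fix \<sigma> :: "nat \<Rightarrow> 'a \<times> 'b"
    assume C: "\<And>e. 0 < e \<Longrightarrow> \<exists>k. \<forall>m\<ge>k. \<forall>n\<ge>k. form_dist ?s (\<sigma> m) (\<sigma> n) < e"
    have "\<exists>a. (\<lambda>n. fst (\<sigma> n)) \<longlonglongrightarrow> a"
      by (rule q.form_complete) (meson C fst_le order_le_less_trans)
    moreover have "\<exists>b. (\<lambda>n. snd (\<sigma> n)) \<longlonglongrightarrow> b"
      by (rule r.form_complete) (meson C snd_le order_le_less_trans)
    ultimately obtain a b where "(\<lambda>n. (fst (\<sigma> n), snd (\<sigma> n))) \<longlonglongrightarrow> (a, b)"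
      using tendsto_Pair by blast
    then show "\<exists>l. \<sigma> \<longlonglongrightarrow> l"
      by auto
  qed
qed

section \<open>The inner product of a fundamental decomposition\<close>

locale krein_decomposition = hermitian_space b
  for b :: "'a::complex_vector \<Rightarrow> 'a \<Rightarrow> complex" +
  fixes P N :: "'a set"
  assumes decomposition: "fundamental_decomposition b P N"
begin

abbreviation "J \<equiv> fundamental_symmetry P N"
abbreviation "q \<equiv> associated_inner b P N"

lemma csubspace_P: "csubspace P"
  and csubspace_N: "csubspace N"
  and pos_P: "p \<in> P \<Longrightarrow> p \<noteq> 0 \<Longrightarrow> 0 < Re (b p p)"
  and neg_N: "n \<in> N \<Longrightarrow> n \<noteq> 0 \<Longrightarrow> Re (b n n) < 0"
  and mcomplete_P: "Metric_space.mcomplete P (form_dist b)"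
  and mcomplete_N: "Metric_space.mcomplete N (form_dist (\<lambda>x y. - b x y))"
  and orth_PN: "p \<in> P \<Longrightarrow> n \<in> N \<Longrightarrow> b p n = 0"
  and inter_PN: "P \<inter> N = {0}"
  using decomposition by (auto simp: fundamental_decomposition_def hilbert_subspace_def)

lemma orth_NP: "p \<in> P \<Longrightarrow> n \<in> N \<Longrightarrow> b n p = 0"
  using form_cnj[of p n] orth_PN[of p n] by simp

lemma decompose:
  obtains p n where "p \<in> P" "n \<in> N" "x = p + n"
  using decomposition unfolding fundamental_decomposition_def by metis

lemma J_add:
  assumes "p \<in> P" "n \<in> N"
  shows "J (p + n) = p - n"
  unfolding fundamental_symmetry_def
proof (rule the_equality)
  fix z assume "\<exists>p'\<in>P. \<exists>n'\<in>N. p + n = p' + n' \<and> z = p' - n'"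
  then obtain p' n' where pn: "p' \<in> P" "n' \<in> N" "p + n = p' + n'" "z = p' - n'"
    by blast
  have "p - p' \<in> P" "n' - n \<in> N"
    using assms pn csubspace_diff csubspace_P csubspace_N by blast+
  moreover have "p - p' = n' - n"
    using pn(3) by (simp add: algebra_simps)
  ultimately have "p - p' \<in> P \<inter> N" "n' - n \<in> P \<inter> N"
    by simp_all
  then have "p = p'" "n = n'"
    by (simp_all add: inter_PN)
  then show "z = p - n"
    using pn(4) by simp
qed (use assms in blast)

lemma J_J: "J (J x) = x"
proof -
  obtain p n where pn: "p \<in> P" "n \<in> N" "x = p + n"
    by (rule decompose)
  have "- n \<in> N"
    using csubspace_N csubspace_diff[of N 0 n] pn by (simp add: csubspace_def)
  then show ?thesis
    using J_add[of p "- n"] J_add[of p n] pn by simp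
qed

lemma q_decomposed:
  assumes "p \<in> P" "n \<in> N" "p' \<in> P" "n' \<in> N"
  shows "q (p + n) (p' + n') = b p p' - b n n'"
  using assms by (simp add: associated_inner_def J_add form_simps orth_PN orth_NP)

text \<open>Since \<open>q x y\<close> is \<open>b (J x) y\<close>, this says that the fundamental symmetry is
  self-adjoint for the Krein form, which makes \<open>q\<close> Hermitian.\<close>

lemma b_J: "b x (J y) = q x y"
proof -
  obtain p n where x: "p \<in> P" "n \<in> N" "x = p + n"
    by (rule decompose)
  obtain p' n' where y: "p' \<in> P" "n' \<in> N" "y = p' + n'"
    by (rule decompose)
  show ?thesis
    using x y by (simp add: q_decomposed J_add form_simps orth_PN orth_NP)
qed

sublocale inner: positive_form q
proof
  have add: "q z (x + y) = q z x + q z y" "q z (c *\<^sub>C x) = cnj c * q z x" for x y z c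
    by (simp_all add: associated_inner_def form_simps)
  have cnj: "cnj (q x y) = q y x" for x y
    by (metis b_J associated_inner_def form_cnj)
  have "q (x + y) z = q x z + q y z" "q (c *\<^sub>C x) z = c * q x z" for x y z c
    by (metis add(1) cnj complex_cnj_add, metis add(2) cnj complex_cnj_mult complex_cnj_cnj)
  then show "hermitian_form q"
    by (simp add: hermitian_form_def cnj)
  fix x :: 'a assume "x \<noteq> 0"
  obtain p n where x: "p \<in> P" "n \<in> N" "x = p + n"
    by (rule decompose)
  then have "p \<noteq> 0 \<or> n \<noteq> 0"
    using \<open>x \<noteq> 0\<close> by auto
  moreover have "Re (q x x) = Re (b p p) - Re (b n n)"
    using x by (simp add: q_decomposed)
  ultimately show "0 < Re (q x x)"
    using pos_P[OF x(1)] neg_N[OF x(2)]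
    by (cases "p = 0"; cases "n = 0") (auto simp: form_simps)
qed

lemma form_dist_P:
  assumes "p \<in> P" "p' \<in> P"
  shows "form_dist b p p' = form_dist q p p'"
proof -
  have "p - p' \<in> P" "0 \<in> N"
    using assms csubspace_P csubspace_N csubspace_diff by (auto simp: csubspace_def)
  then show ?thesis
    using q_decomposed[of "p - p'" 0 "p - p'" 0] by (simp add: form_dist_def form_simps)
qed

lemma form_dist_N:
  assumes "n \<in> N" "n' \<in> N"
  shows "form_dist (\<lambda>x y. - b x y) n n' = form_dist q n n'"
proof -
  have "n - n' \<in> N" "0 \<in> P"
    using assms csubspace_P csubspace_N csubspace_diff by (auto simp: csubspace_def)
  then show ?thesis
    using q_decomposed[of 0 "n - n'" 0 "n - n'"] by (simp add: form_dist_def form_simps)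
qed

text \<open>The two summands of a decomposition are also orthogonal for \<open>q\<close>, and the theorem of
  Pythagoras applies.\<close>

lemma form_dist_components_le:
  assumes "p \<in> P" "n \<in> N" "p' \<in> P" "n' \<in> N"
  shows "form_dist q p p' \<le> form_dist q (p + n) (p' + n')"
    and "form_dist q n n' \<le> form_dist q (p + n) (p' + n')"
proof -
  have diff: "p - p' \<in> P" "n - n' \<in> N" "0 \<in> N" "0 \<in> P"
    using assms csubspace_P csubspace_N csubspace_diff by (auto simp: csubspace_def)
  have "q (p - p') (n - n') = 0"
    using q_decomposed[of "p - p'" 0 0 "n - n'"] diff by (simp add: form_simps)
  then have "(inner.form_norm ((p - p') + (n - n')))\<^sup>2
      = (inner.form_norm (p - p'))\<^sup>2 + (inner.form_norm (n - n'))\<^sup>2"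
    by (simp add: inner.form_norm_add_square)
  then have "(form_dist q (p + n) (p' + n'))\<^sup>2 = (form_dist q p p')\<^sup>2 + (form_dist q n n')\<^sup>2"
    by (simp add: inner.form_dist_norm add_diff_add)
  then show "form_dist q p p' \<le> form_dist q (p + n) (p' + n')"
    and "form_dist q n n' \<le> form_dist q (p + n) (p' + n')"
    by (auto intro!: power2_le_imp_le[OF _ inner.form_dist_nonneg])
qed

text \<open>On \<open>P\<close> and on \<open>N\<close> completeness is given for the distances of \<open>b\<close> and of
  \<open>- b\<close>.  These agree with the distance of \<open>q\<close> only inside the respective subspace, and
  need not satisfy the triangle inequality elsewhere; hence the separate distance \<open>d\<close>.\<close>

lemma complete_on:
  assumes d_eq: "\<And>x y. x \<in> V \<Longrightarrow> y \<in> V \<Longrightarrow> d x y = form_dist q x y"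
    and d: "\<And>x y. 0 \<le> d x y" "\<And>x y. d x y = d y x"
    and complete: "Metric_space.mcomplete V d"
    and \<sigma>: "\<And>n. \<sigma> n \<in> V" "\<And>e. 0 < e \<Longrightarrow> \<exists>k. \<forall>m\<ge>k. \<forall>n\<ge>k. form_dist q (\<sigma> m) (\<sigma> n) < e"
  obtains l where "l \<in> V" "(\<lambda>n. form_dist q (\<sigma> n) l) \<longlonglongrightarrow> 0"
proof -
  interpret V: Metric_space V d
    using d by unfold_locales
      (auto simp: d_eq inner.form_dist_eq_0 intro: inner.form_dist_triangle)
  have "V.MCauchy \<sigma>"
    unfolding V.MCauchy_def using \<sigma> by (auto simp: d_eq)
  then obtain l where l: "limitin V.mtopology \<sigma> l sequentially"
    using complete by (auto simp: V.mcomplete_def)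
  then have "l \<in> V"
    by (simp add: V.limitin_metric)
  moreover have "(\<lambda>n. form_dist q (\<sigma> n) l) \<longlonglongrightarrow> 0"
  proof (rule tendstoI)
    fix e :: real assume "0 < e"
    then have "\<forall>\<^sub>F n in sequentially. d (\<sigma> n) l < e"
      using l by (auto simp: V.limitin_metric elim: eventually_mono)
    then show "\<forall>\<^sub>F n in sequentially. dist (form_dist q (\<sigma> n) l) 0 < e"
      by (simp add: d_eq \<sigma> \<open>l \<in> V\<close> inner.form_dist_nonneg)
  qed
  ultimately show thesis ..
qed

lemma complete_inner:
  assumes C: "\<And>e. 0 < e \<Longrightarrow> \<exists>k. \<forall>m\<ge>k. \<forall>n\<ge>k. form_dist q (\<sigma> m) (\<sigma> n) < e"
  obtains l where "(\<lambda>n. form_dist q (\<sigma> n) l) \<longlonglongrightarrow> 0"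
proof -
  have "\<exists>p n. p \<in> P \<and> n \<in> N \<and> \<sigma> k = p + n" for k
    using decompose[of "\<sigma> k"] by metis
  then obtain p n where pn: "\<And>k. p k \<in> P" "\<And>k. n k \<in> N" and \<sigma>: "\<And>k. \<sigma> k = p k + n k"
    by metis
  have le: "form_dist q (p i) (p j) \<le> form_dist q (\<sigma> i) (\<sigma> j)"
    "form_dist q (n i) (n j) \<le> form_dist q (\<sigma> i) (\<sigma> j)" for i j
    unfolding \<sigma> by (rule form_dist_components_le; rule pn)+
  obtain p' where p': "(\<lambda>k. form_dist q (p k) p') \<longlonglongrightarrow> 0"
  proof (rule complete_on[OF form_dist_P _ form_dist_commute mcomplete_P pn(1)])
    show "\<exists>k. \<forall>i\<ge>k. \<forall>j\<ge>k. form_dist q (p i) (p j) < e" if "0 < e" for e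
      using C[OF that] le(1) by (meson order_le_less_trans)
  qed (auto simp: form_dist_def)
  interpret neg: hermitian_space "\<lambda>x y. - b x y"
  proof
    show "hermitian_form (\<lambda>x y. - b x y)"
      unfolding hermitian_form_def
      by (intro conjI allI) (simp_all add: form_simps form_cnj)
  qed
  obtain n' where n': "(\<lambda>k. form_dist q (n k) n') \<longlonglongrightarrow> 0"
  proof (rule complete_on[OF form_dist_N _ neg.form_dist_commute mcomplete_N pn(2)])
    show "\<exists>k. \<forall>i\<ge>k. \<forall>j\<ge>k. form_dist q (n i) (n j) < e" if "0 < e" for e
      using C[OF that] le(2) by (meson order_le_less_trans)
  qed (auto simp: form_dist_def)
  have "(\<lambda>k. form_dist q (p k) p' + form_dist q (n k) n') \<longlonglongrightarrow> 0"
    using tendsto_add[OF p' n'] by simp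
  then have "(\<lambda>k. form_dist q (\<sigma> k) (p' + n')) \<longlonglongrightarrow> 0"
    by (rule tendsto_sandwich[OF _ _ tendsto_const, rotated 2])
      (auto simp: \<sigma> inner.form_dist_nonneg inner.form_dist_add)
  then show thesis ..
qed

end

text \<open>The first equation translates orthogonality for \<open>q\<close> into an equation of Krein forms,
  the second carries the continuity of \<open>q\<close> over to the Krein form.\<close>

lemma krein_hilbert_form:
  obtains q :: "'a::krein_space \<Rightarrow> 'a \<Rightarrow> complex" and J
  where "hilbert_form q" "\<And>x y. q x y = krein_form x (J y)" "\<And>x y. krein_form x y = q x (J y)"
proof -
  obtain P N where PN: "fundamental_decomposition (krein_form :: 'a \<Rightarrow> 'a \<Rightarrow> complex) P N"
    and top: "\<And>U :: 'a set. open U \<longleftrightarrow>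
      openin (Metric_space.mtopology UNIV (form_dist (associated_inner krein_form P N))) U"
    using ex_fundamental_decomposition by blast
  interpret krein_decomposition "krein_form :: 'a \<Rightarrow> 'a \<Rightarrow> complex" P N
    using hermitian_krein_form PN by unfold_locales
  interpret m: Metric_space UNIV "form_dist q"
    by (rule inner.Metric_space_form_dist)
  have nhds: "nhds l = filtercomap (\<lambda>x. form_dist q x l) (nhds 0)" (is "_ = ?F") for l
  proof (rule antisym)
    have "((\<lambda>x. form_dist q x l) \<longlongrightarrow> 0) (nhds l)"
    proof (rule tendstoI)
      fix e :: real assume "0 < e"
      have "open (m.mball l e)"
        by (simp add: top m.openin_mball)
      moreover have "l \<in> m.mball l e"
        using \<open>0 < e\<close> by simp
      ultimately have "\<forall>\<^sub>F x in nhds l. x \<in> m.mball l e"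
        by (rule eventually_nhds_in_open)
      then show "\<forall>\<^sub>F x in nhds l. dist (form_dist q x l) 0 < e"
        by eventually_elim (simp add: m.commute)
    qed
    then show "nhds l \<le> ?F"
      by (simp add: filterlim_iff_le_filtercomap)
  next
    have lim0: "((\<lambda>x. form_dist q x l) \<longlongrightarrow> 0) ?F"
      by (rule filterlim_filtercomap)
    have "((\<lambda>x. x) \<longlongrightarrow> l) ?F"
    proof (rule topological_tendstoI)
      fix U assume "open U" "l \<in> U"
      then obtain e where e: "0 < e" "m.mball l e \<subseteq> U"
        by (auto simp: top m.openin_mtopology)
      have "\<forall>\<^sub>F x in ?F. form_dist q x l < e"
        using order_tendstoD(2)[OF lim0 e(1)] .
      then show "\<forall>\<^sub>F x in ?F. x \<in> U"
        by eventually_elim (use e(2) in \<open>auto simp: m.commute\<close>)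
    qed
    then show "?F \<le> nhds l"
      by (simp add: filterlim_def filtermap_ident)
  qed
  have "hilbert_form q"
  proof
    fix \<sigma> :: "nat \<Rightarrow> 'a"
    assume C: "\<And>e. 0 < e \<Longrightarrow> \<exists>k. \<forall>m\<ge>k. \<forall>n\<ge>k. form_dist q (\<sigma> m) (\<sigma> n) < e"
    obtain l where "(\<lambda>n. form_dist q (\<sigma> n) l) \<longlonglongrightarrow> 0"
      using complete_inner[OF C] .
    then show "\<exists>l. \<sigma> \<longlonglongrightarrow> l"
      by (auto simp: nhds filterlim_filtercomap_iff o_def)
  qed (rule nhds)
  moreover have "krein_form x y = q x (J y)" for x y
    using b_J[of x "J y"] by (simp add: J_J)
  ultimately show thesis
    using b_J that by metis
qed

section \<open>Adjoint relations\<close>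

interpretation krein: hermitian_space krein_form
  by unfold_locales (rule hermitian_krein_form)

lemma continuous_krein_form: "continuous_on UNIV (\<lambda>x :: 'a::krein_space. krein_form x y)"
proof -
  obtain q J where "hilbert_form q" and q: "\<And>x y :: 'a. krein_form x y = q x (J y)"
    using krein_hilbert_form by metis
  then show ?thesis
    unfolding q by (intro hilbert_form.continuous_form_left)
qed

lemma closed_annihilator: "closed {(f, g). krein_form f h = krein_form g k}"
proof -
  have "continuous_on UNIV (\<lambda>z. krein_form (fst z) h)"
    "continuous_on UNIV (\<lambda>z. krein_form (snd z) k)"
    by (auto intro!: continuous_on_compose2[OF continuous_krein_form] continuous_intros)
  from closed_Collect_eq[OF this] show ?thesis
    by (simp add: case_prod_unfold)
qed

text \<open>Conjugating the defining equation puts the variable pair \<open>(k, h)\<close> into the first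
  arguments, where it stands in \<open>closed_annihilator\<close>.\<close>

lemma mem_rel_adjoint_iff:
  "(k, h) \<in> rel_adjoint H \<longleftrightarrow> (\<forall>(f, g)\<in>H. krein_form k g = krein_form h f)"
proof -
  have "krein_form f h = krein_form g k \<longleftrightarrow> krein_form k g = krein_form h f" for f g
    using krein.form_cnj[of f h] krein.form_cnj[of g k] complex_cnj_cancel_iff by metis
  then show ?thesis
    by (simp add: rel_adjoint_def)
qed

lemma closed_rel_adjoint: "closed (rel_adjoint H)"
proof -
  have "rel_adjoint H = (\<Inter>(f, g)\<in>H. {(k, h). krein_form k g = krein_form h f})"
    by (auto simp: mem_rel_adjoint_iff)
  then show ?thesis
    using closed_annihilator by (auto intro!: closed_INT)
qed

lemma linear_rel_adjoint: "linear_relation (rel_adjoint H)"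
  by (auto simp: linear_relation_def csubspace_def rel_adjoint_def zero_prod_def
      scaleC_prod_def krein.form_simps) fastforce+

lemma rel_adjoint_closure: "rel_adjoint (closure H) = rel_adjoint H"
proof
  show "rel_adjoint (closure H) \<subseteq> rel_adjoint H"
    using closure_subset by (fastforce simp: rel_adjoint_def)
  show "rel_adjoint H \<subseteq> rel_adjoint (closure H)"
  proof clarify
    fix k h assume kh: "(k, h) \<in> rel_adjoint H"
    then have "closure H \<subseteq> {(f, g). krein_form f h = krein_form g k}"
      by (intro closure_minimal closed_annihilator) (auto simp: rel_adjoint_def)
    then show "(k, h) \<in> rel_adjoint (closure H)"
      by (auto simp: rel_adjoint_def)
  qed
qed

lemma closure_subset_double_adjoint: "closure H \<subseteq> rel_adjoint (rel_adjoint H)"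
proof (rule closure_minimal[OF _ closed_rel_adjoint])
  show "H \<subseteq> rel_adjoint (rel_adjoint H)"
    by (clarsimp simp: rel_adjoint_def[of "rel_adjoint H"]) (auto simp: mem_rel_adjoint_iff)
qed

lemma double_adjoint:
  fixes H :: "('a::krein_space \<times> 'b::krein_space) set"
  assumes "linear_relation H"
  shows "rel_adjoint (rel_adjoint H) = closure H"
proof
  show "closure H \<subseteq> rel_adjoint (rel_adjoint H)"
    by (rule closure_subset_double_adjoint)
  show "rel_adjoint (rel_adjoint H) \<subseteq> closure H"
  proof
    fix z assume z: "z \<in> rel_adjoint (rel_adjoint H)"
    obtain q J where q: "hilbert_form q" "\<And>x y :: 'a. q x y = krein_form x (J y)"
      using krein_hilbert_form by metis
    obtain r K where r: "hilbert_form r" "\<And>x y :: 'b. r x y = krein_form x (K y)"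
      using krein_hilbert_form by metis
    interpret s: hilbert_form "\<lambda>z w. q (fst z) (fst w) + r (snd z) (snd w)"
      using hilbert_form_prod[OF q(1) r(1)] .
    obtain l where l: "l \<in> closure H"
      and orth: "\<And>v. v \<in> H \<Longrightarrow> q (fst v) (fst (z - l)) + r (snd v) (snd (z - l)) = 0"
      using s.orthogonal_decomposition[of H z] assms unfolding linear_relation_def by metis
    define w where "w = z - l"
    \<comment> \<open>Moving \<open>J\<close> and \<open>K\<close> to the second arguments turns orthogonality to \<open>w\<close> into
      the defining equation of the adjoint, with a sign from bringing the second summand to the
      other side.\<close>
    have w: "(- K (snd w), J (fst w)) \<in> rel_adjoint H"
      using orth by (auto simp: rel_adjoint_def w_def[symmetric] q(2) r(2) krein.form_simps
          eq_neg_iff_add_eq_0)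
    have annihilated: "q (fst u) (fst w) + r (snd u) (snd w) = 0"
      if "u \<in> rel_adjoint (rel_adjoint H)" for u
    proof -
      have "krein_form (fst u) (J (fst w)) = krein_form (snd u) (- K (snd w))"
        using that w by (cases u) (auto simp: mem_rel_adjoint_iff)
      then show ?thesis
        by (simp add: q(2) r(2) krein.form_minus_right)
    qed
    have "q (fst z) (fst w) + r (snd z) (snd w) = 0" "q (fst l) (fst w) + r (snd l) (snd w) = 0"
      using annihilated z l closure_subset_double_adjoint[of H] by blast+
    then have "q (fst w) (fst w) + r (snd w) (snd w) = 0"
      using s.form_diff_left[of z l w] by (simp add: w_def)
    then have "w = 0"
      using s.form_pos[of w] by force
    then show "z \<in> closure H"
      using l by (simp add: w_def)
  qed
qed

lemma krein_orth_Domain: "krein_orth (Domain H) = rel_mul (rel_adjoint H)"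
  by (auto simp: krein_orth_def rel_mul_def rel_adjoint_def krein.form_zero_right)

lemma rel_ker_adjoint: "rel_ker (rel_adjoint H) = krein_orth (Range H)"
  by (fastforce simp: krein_orth_def rel_ker_def rel_adjoint_def krein.form_zero_right)

lemma closure_image_closure:
  assumes "continuous_on UNIV f"
  shows "closure (f ` closure H) = closure (f ` H)"
proof
  have "f ` closure H \<subseteq> closure (f ` H)"
    using continuous_on_subset[OF assms subset_UNIV] closed_closure closure_subset
    by (rule image_closure_subset)
  then show "closure (f ` closure H) \<subseteq> closure (f ` H)"
    by (simp add: closure_minimal)
  show "closure (f ` H) \<subseteq> closure (f ` closure H)"
    by (intro closure_mono image_mono closure_subset)
qed

theorem proposition3p3:
  fixes H :: "('a::krein_space \<times> 'b::krein_space) set"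
  assumes "linear_relation H"
  shows "(linear_relation (rel_adjoint H) \<and> closed (rel_adjoint H)) \<and>
    rel_adjoint (closure H) = rel_adjoint H \<and>
    closure H = rel_adjoint (rel_adjoint H) \<and>
    krein_orth (Domain H) = rel_mul (rel_adjoint H) \<and>
    rel_ker (rel_adjoint H) = krein_orth (Range H) \<and>
    (closure (Domain (closure H)) = closure (Domain H) \<and>
     closure (Range (closure H)) = closure (Range H))"
proof -
  have "closure (Domain (closure H)) = closure (Domain H)"
    unfolding Domain_fst by (intro closure_image_closure continuous_on_fst continuous_on_id)
  moreover have "closure (Range (closure H)) = closure (Range H)"
    unfolding Range_snd by (intro closure_image_closure continuous_on_snd continuous_on_id)
  ultimately show ?thesis
    using linear_rel_adjoint closed_rel_adjoint rel_adjoint_closure double_adjoint[OF assms]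
      krein_orth_Domain rel_ker_adjoint by metis
qed

end
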